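(* Let $1\le p<\infty$ and let $v$ be a weight on $Y$. If $\|\cdot\|_{\Lambda^p_{\mathcal R}(v)}$ is a norm then, for all $A,B\in\Sigma_X$, $$V(\mathcal R(A\cup B))+V(\mathcal R(A\cap B))\le V(\mathcal R(A))+V(\mathcal R(B)).$$
   Context: $(X,\Sigma_X,\mu)$ and $(Y,\Sigma_Y,\nu)$ are $\sigma$-finite measure spaces and $\mathcal R:\Sigma_X\to\Sigma_Y$ is a set transformation with $\nu(\mathcal R(\emptyset))=0$. For a $\mu$-measurable function $f$ on $X$, its rearrangement is $f^*_{\mathcal R}(y)=\int_0^\infty \chi_{\mathcal R(\{x\in X:|f(x)|>t\})}(y)\,dt$, $y\in Y$ (whenever this defines a $\nu$-measurable function). $\mathcal R$ is assumed to satisfy the Fatou property: for every increasing sequence of non-negative measurable functions $f_n$ on $X$ converging to $f$ $\mu$-a.e., $(f_n)^*_{\mathcal R}$ converges increasingly to $f^*_{\mathcal R}$ $\nu$-a.e. A weight on $Y$ is a function $v\in L^1_{\mathrm{loc}}(Y,d\nu)$ (i.e. integrable over sets of finite $\nu$-measure), $v\ge 0$, such that $\mu(A)>0$ implies $\int_{\mathcal R(A)}v\,d\nu>0$ for $A\in\Sigma_X$. Put $V(E)=\int_E v\,d\nu$ for measurable $E\subset Y$. The Lorentz space $\Lambda^p_{\mathcal R}(v)$ consists of the $\mu$-measurable $f$ on $X$ (modulo $\mu$-a.e. equality) for which $$\|f\|_{\Lambda^p_{\mathcal R}(v)}=\Bigl(\int_Y (f^*_{\mathcal R}(y))^p\,v(y)\,d\nu(y)\Bigr)^{1/p}$$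 is finite. *)

theory Defs
  imports "HOL-Analysis.Analysis"
begin

locale set_transformation =
  X: sigma_finite_measure M + Y: sigma_finite_measure N
  for M :: "'a measure" and N :: "'b measure" +
  fixes R :: "'a set \<Rightarrow> 'b set"
  assumes R_sets: "A \<in> sets M \<Longrightarrow> R A \<in> sets N"
    and R_empty: "emeasure N (R {}) = 0"

definition superlevel :: "'a measure \<Rightarrow> ('a \<Rightarrow> real) \<Rightarrow> real \<Rightarrow> 'a set" where
  "superlevel M f t = {x \<in> space M. \<bar>f x\<bar> > t}"

text \<open>Functions on \<open>X\<close> are finite-valued, but the rearrangement may take the value \<open>\<infinity>\<close>
  (e.g. on the null set \<open>R {}\<close>).\<close>

definition rearr :: "'a measure \<Rightarrow> ('a set \<Rightarrow> 'b set) \<Rightarrow> ('a \<Rightarrow> real) \<Rightarrow> 'b \<Rightarrow> ennreal" where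
  "rearr M R f y = (\<integral>\<^sup>+t\<in>{0<..}. indicator (R (superlevel M f t)) y \<partial>lebesgue)"

text \<open>\<open>nn_integral\<close> is total (a lower integral on non-measurable integrands), so \<open>rearr\<close> always has
  a value; the next predicate says that its defining formula really is an integral for almost
  every \<open>y\<close> and yields a \<open>\<nu>\<close>-measurable function, i.e. one measurable up to a null set.\<close>

definition rearrangeable ::
    "'a measure \<Rightarrow> 'b measure \<Rightarrow> ('a set \<Rightarrow> 'b set) \<Rightarrow> ('a \<Rightarrow> real) \<Rightarrow> bool" where
  "rearrangeable M N R f \<longleftrightarrow>
     (AE y in N. {t \<in> {0<..}. y \<in> R (superlevel M f t)} \<in> sets lebesgue) \<and>
     rearr M R f \<in> borel_measurable (completion N)"

definition fatou_property :: "'a measure \<Rightarrow> 'b measure \<Rightarrow> ('a set \<Rightarrow> 'b set) \<Rightarrow> bool" where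
  "fatou_property M N R \<longleftrightarrow>
     (\<forall>(F :: nat \<Rightarrow> 'a \<Rightarrow> real) f.
        (\<forall>n. F n \<in> borel_measurable M) \<and> f \<in> borel_measurable M \<and>
        (\<forall>n. \<forall>x\<in>space M. 0 \<le> F n x) \<and>
        (\<forall>x\<in>space M. incseq (\<lambda>n. F n x)) \<and>
        (AE x in M. (\<lambda>n. F n x) \<longlonglongrightarrow> f x) \<longrightarrow>
        (AE y in N. incseq (\<lambda>n. rearr M R (F n) y) \<and>
                    (\<lambda>n. rearr M R (F n) y) \<longlonglongrightarrow> rearr M R f y))"

definition Vmeas :: "'b measure \<Rightarrow> ('b \<Rightarrow> real) \<Rightarrow> 'b set \<Rightarrow> ennreal" where
  "Vmeas N v E = (\<integral>\<^sup>+y\<in>E. ennreal (v y) \<partial>N)"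

definition weight ::
    "'a measure \<Rightarrow> 'b measure \<Rightarrow> ('a set \<Rightarrow> 'b set) \<Rightarrow> ('b \<Rightarrow> real) \<Rightarrow> bool" where
  "weight M N R v \<longleftrightarrow>
     v \<in> borel_measurable N \<and>
     (\<forall>E\<in>sets N. emeasure N E < \<infinity> \<longrightarrow> set_integrable N E v) \<and>
     (AE y in N. 0 \<le> v y) \<and>
     (\<forall>A\<in>sets M. emeasure M A > 0 \<longrightarrow> Vmeas N v (R A) > 0)"

text \<open>Real powers on \<open>[0,\<infinity>]\<close>, for exponents \<open>p > 0\<close> only.\<close>

definition epowr :: "ennreal \<Rightarrow> real \<Rightarrow> ennreal" where
  "epowr x p = (if x = \<infinity> then \<infinity> else ennreal (enn2real x powr p))"

definition lorentz_norm ::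
    "'a measure \<Rightarrow> 'b measure \<Rightarrow> ('a set \<Rightarrow> 'b set) \<Rightarrow> real \<Rightarrow> ('b \<Rightarrow> real) \<Rightarrow> ('a \<Rightarrow> real) \<Rightarrow> ennreal" where
  "lorentz_norm M N R p v f =
     epowr (\<integral>\<^sup>+y. epowr (rearr M R f y) p * ennreal (v y) \<partial>N) (1 / p)"

definition lorentz_space ::
    "'a measure \<Rightarrow> 'b measure \<Rightarrow> ('a set \<Rightarrow> 'b set) \<Rightarrow> real \<Rightarrow> ('b \<Rightarrow> real) \<Rightarrow> ('a \<Rightarrow> real) set" where
  "lorentz_space M N R p v =
     {f \<in> borel_measurable M. rearrangeable M N R f \<and> lorentz_norm M N R p v f < \<infinity>}"

text \<open>\<open>\<rho>\<close> induces a norm on the real vector space obtained from \<open>S\<close> by identifying functions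
  that agree almost everywhere. That \<open>\<rho>\<close> is constant on the classes need not be required: if
  \<open>f, g \<in> S\<close> agree a.e. then \<open>\<rho> (f - g) = 0\<close>, so \<open>\<rho> f = \<rho> g\<close> by the triangle inequality.\<close>

definition is_norm_mod_AE ::
    "'a measure \<Rightarrow> ('a \<Rightarrow> real) set \<Rightarrow> (('a \<Rightarrow> real) \<Rightarrow> ennreal) \<Rightarrow> bool" where
  "is_norm_mod_AE M S \<rho> \<longleftrightarrow>
     (\<lambda>x. 0) \<in> S \<and>
     (\<forall>f\<in>S. \<forall>g\<in>S. (\<lambda>x. f x + g x) \<in> S) \<and>
     (\<forall>c. \<forall>f\<in>S. (\<lambda>x. c * f x) \<in> S) \<and>
     (\<forall>f\<in>S. \<rho> f < \<infinity>) \<and>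
     (\<forall>f\<in>S. \<rho> f = 0 \<longleftrightarrow> (AE x in M. f x = 0)) \<and>
     (\<forall>c. \<forall>f\<in>S. \<rho> (\<lambda>x. c * f x) = ennreal \<bar>c\<bar> * \<rho> f) \<and>
     (\<forall>f\<in>S. \<forall>g\<in>S. \<rho> (\<lambda>x. f x + g x) \<le> \<rho> f + \<rho> g)"

end

theory Submission
  imports Defs
begin

text \<open>
  Write \<open>W\<close> for the set function \<open>A \<mapsto> V(R A)\<close>. The claim says that \<open>W\<close> is submodular, and it is what
  the triangle inequality becomes to first order when it is applied to small perturbations of one
  indicator function. With \<open>D = A \<union> B\<close> and \<open>\<delta> > 0\<close> let \<open>f = \<chi>\<^sub>D + \<delta>\<chi>\<^sub>A\<close> and \<open>g = \<chi>\<^sub>D + \<delta>\<chi>\<^sub>B\<close>. Since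
  \<open>\<chi>\<^sub>A + \<chi>\<^sub>B = \<chi>\<^sub>D + \<chi>\<^bsub>A \<inter> B\<^esub>\<close>, the sum is \<open>f + g = (2 + \<delta>)\<chi>\<^sub>D + \<delta>\<chi>\<^bsub>A \<inter> B\<^esub>\<close>; so all three functions take two
  values on nested sets.

  The Fatou property forces \<open>R\<close> to be monotone up to null sets, because a sequence that jumps once
  from \<open>\<chi>\<^sub>C\<close> to \<open>\<chi>\<^sub>D\<close> is increasing. Hence for \<open>C \<subseteq> D\<close> the rearrangement of \<open>a\<chi>\<^sub>D + d\<chi>\<^sub>C\<close> is almost
  everywhere the corresponding two-valued function on the nested sets \<open>R C \<subseteq> R D\<close>, and
  \<open>\<parallel>a\<chi>\<^sub>D + d\<chi>\<^sub>C\<parallel>\<^sup>p = a\<^sup>p W(D) + ((a + d)\<^sup>p - a\<^sup>p) W(C)\<close> (lemma \<open>nn_integral_rearr_nested_step\<close>).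

  The triangle inequality for \<open>f\<close> and \<open>g\<close> is therefore an inequality between explicit functions of
  \<open>\<delta>\<close> which is an equality at \<open>\<delta> = 0\<close>. Comparing the one-sided derivatives there, both of which
  contain the factor \<open>W(D) powr (1/p - 1)\<close>, gives \<open>W(D) + W(A \<inter> B) \<le> W(A) + W(B)\<close>
  (lemma \<open>submodular_from_minkowski\<close>). This needs \<open>0 < W(D) < \<infinity>\<close>. The case \<open>W(D) = 0\<close> is trivial by
  monotonicity, and if \<open>W(A)\<close> and \<open>W(B)\<close> are finite then so is \<open>W(D)\<close>, because \<open>\<chi>\<^sub>A + \<chi>\<^sub>B\<close> lies in
  the Lorentz space.
\<close>

section \<open>Rearrangement of a function with two nested levels\<close>

definition nested_step :: "real \<Rightarrow> real \<Rightarrow> 'a set \<Rightarrow> 'a set \<Rightarrow> 'a \<Rightarrow> real" where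
  "nested_step a d D C x = a * indicator D x + d * indicator C x"

lemma borel_measurable_nested_step [measurable]:
  assumes [measurable]: "C \<in> sets M" "D \<in> sets M"
  shows "nested_step a d D C \<in> borel_measurable M"
  unfolding nested_step_def[abs_def] by measurable

lemma superlevel_nested_step:
  assumes "0 < a" "0 \<le> d" "C \<subseteq> D" "D \<subseteq> space M" "0 < t"
  shows "superlevel M (nested_step a d D C) t = (if t < a then D else if t < a + d then C else {})"
  using assms by (auto simp: superlevel_def nested_step_def indicator_def)

lemma emeasure_lborel_Ici: "emeasure lborel {b::real..} = \<infinity>"
proof (cases "emeasure lborel {b..}")
  case (real r)
  have "ennreal (r + 1) = emeasure lborel {b..b + (r + 1)}"
    using real by simp
  also have "\<dots> \<le> emeasure lborel {b..}"
    by (intro emeasure_mono) auto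
  finally show ?thesis
    using real by simp
qed simp

text \<open>The last summand is the contribution of the heights \<open>t \<ge> a + d\<close>, whose superlevel set is empty:
  on \<open>R {}\<close>, which is a null set but need not be empty, the rearrangement is infinite.\<close>

lemma rearr_nested_step:
  assumes "0 < a" "0 \<le> d" "C \<subseteq> D" "D \<subseteq> space M"
  shows "rearr M R (nested_step a d D C) y =
    ennreal a * indicator (R D) y + ennreal d * indicator (R C) y + \<infinity> * indicator (R {}) y"
proof -
  have "rearr M R (nested_step a d D C) y =
      (\<integral>\<^sup>+t. (indicator (R D) y * indicator {0<..<a} t + indicator (R C) y * indicator {a..<a+d} t)
         + indicator (R {}) y * indicator {a+d..} t \<partial>lebesgue)"
    unfolding rearr_def
    using assms by (intro nn_integral_cong)
      (auto simp: superlevel_nested_step split: split_indicator)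
  also have "\<dots> = (\<integral>\<^sup>+t. (indicator (R D) y * indicator {0<..<a} t + indicator (R C) y * indicator {a..<a+d} t)
         + indicator (R {}) y * indicator {a+d..} t \<partial>lborel)"
    by (rule nn_integral_completion)
  also have "\<dots> = indicator (R D) y * emeasure lborel {0<..<a} + indicator (R C) y * emeasure lborel {a..<a+d}
         + indicator (R {}) y * emeasure lborel {a+d..}"
    by (simp add: nn_integral_add nn_integral_cmult)
  also have "\<dots> = ennreal a * indicator (R D) y + ennreal d * indicator (R C) y + \<infinity> * indicator (R {}) y"
    using assms by (simp add: mult.commute emeasure_lborel_Ici)
  finally show ?thesis .
qed

context set_transformation
begin

lemma AE_not_in_R_empty: "AE y in N. y \<notin> R {}"
  using R_empty R_sets[OF sets.empty_sets] by (intro AE_not_in) auto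

lemma rearrangeable_nested_step:
  assumes "0 < a" "0 \<le> d" "C \<subseteq> D" "C \<in> sets M" "D \<in> sets M"
  shows "rearrangeable M N R (nested_step a d D C)"
  unfolding rearrangeable_def
proof
  have D: "D \<subseteq> space M"
    using assms by (simp add: sets.sets_into_space)
  have "{t \<in> {0<..}. y \<in> R (superlevel M (nested_step a d D C) t)} =
      (if y \<in> R D then {0<..<a} else {}) \<union> (if y \<in> R C then {a..<a+d} else {}) \<union>
      (if y \<in> R {} then {a+d..} else {})" for y
    using assms D by (auto simp: superlevel_nested_step split: if_splits)
  then show "AE y in N. {t \<in> {0<..}. y \<in> R (superlevel M (nested_step a d D C) t)} \<in> sets lebesgue"
    by (simp add: sets.Un)
  have [measurable]: "R D \<in> sets N" "R C \<in> sets N" "R {} \<in> sets N"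
    using assms R_sets by auto
  have "rearr M R (nested_step a d D C) \<in> borel_measurable N"
    unfolding rearr_nested_step[OF assms(1-3) D, abs_def] by measurable
  then show "rearr M R (nested_step a d D C) \<in> borel_measurable (completion N)"
    by (rule measurable_completion)
qed

text \<open>The Fatou property is applied to the sequence \<open>\<chi>\<^sub>C, \<chi>\<^sub>D, \<chi>\<^sub>D, \<dots>\<close>.\<close>

lemma fatou_imp_mono_AE:
  assumes F: "fatou_property M N R" and CD: "C \<subseteq> D" "C \<in> sets M" "D \<in> sets M"
  shows "AE y in N. y \<in> R C \<longrightarrow> y \<in> R D"
proof -
  define G where "G n = nested_step 1 0 (if n = 0 then C else D) {}" for n :: nat
  have sub: "C \<subseteq> space M" "D \<subseteq> space M"
    using CD by (auto dest: sets.sets_into_space)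
  have "AE y in N. incseq (\<lambda>n. rearr M R (G n) y) \<and>
      (\<lambda>n. rearr M R (G n) y) \<longlonglongrightarrow> rearr M R (nested_step 1 0 D {}) y"
  proof (rule F[unfolded fatou_property_def, rule_format], intro conjI allI ballI)
    show "AE x in M. (\<lambda>n. G n x) \<longlonglongrightarrow> nested_step 1 0 D {} x"
    proof (intro AE_I2 tendsto_eventually)
      show "\<forall>\<^sub>F n in sequentially. G n x = nested_step 1 0 D {} x" for x
        using eventually_gt_at_top[of 0] by eventually_elim (simp add: G_def)
    qed
    show "incseq (\<lambda>n. G n x)" for x
      using CD by (auto simp: G_def nested_step_def incseq_def indicator_def)
  qed (use CD in \<open>auto simp: G_def nested_step_def indicator_def\<close>)
  then show ?thesis
    using AE_not_in_R_empty
  proof eventually_elim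
    case (elim y)
    then have "rearr M R (G 0) y \<le> rearr M R (G 1) y"
      by (auto simp: incseq_def)
    then show ?case
      using elim sub by (auto simp: G_def rearr_nested_step indicator_def split: if_splits)
  qed
qed

end

section \<open>Lorentz norm of a function with two nested levels\<close>

lemma epowr_ennreal: "0 \<le> x \<Longrightarrow> epowr (ennreal x) p = ennreal (x powr p)"
  by (simp add: epowr_def)

lemma epowr_less_top_iff: "epowr x p < \<infinity> \<longleftrightarrow> x < \<infinity>"
  by (auto simp: epowr_def less_top)

lemma Vmeas_mono_AE:
  assumes "AE y in N. y \<in> E \<longrightarrow> y \<in> F"
  shows "Vmeas N v E \<le> Vmeas N v F"
  unfolding Vmeas_def using assms by (intro nn_integral_mono_AE) (auto split: split_indicator)

context set_transformation
begin

lemma nn_integral_rearr_nested_step: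
  assumes F: "fatou_property M N R" and v [measurable]: "v \<in> borel_measurable N" and "0 < p"
    and ad: "0 < a" "0 \<le> d" and CD: "C \<subseteq> D" "C \<in> sets M" "D \<in> sets M"
  shows "(\<integral>\<^sup>+y. epowr (rearr M R (nested_step a d D C) y) p * ennreal (v y) \<partial>N) =
    ennreal (a powr p) * Vmeas N v (R D) + ennreal ((a + d) powr p - a powr p) * Vmeas N v (R C)"
proof -
  have [measurable]: "R D \<in> sets N" "R C \<in> sets N"
    using CD R_sets by auto
  have D: "D \<subseteq> space M"
    using CD by (simp add: sets.sets_into_space)
  have le: "a powr p \<le> (a + d) powr p"
    using ad \<open>0 < p\<close> by (intro powr_mono2) auto
  have "AE y in N. epowr (rearr M R (nested_step a d D C) y) p * ennreal (v y) =
      ennreal (a powr p) * (ennreal (v y) * indicator (R D) y) +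
      ennreal ((a + d) powr p - a powr p) * (ennreal (v y) * indicator (R C) y)"
    using AE_not_in_R_empty fatou_imp_mono_AE[OF F CD]
  proof eventually_elim
    case (elim y)
    then consider "y \<in> R C" "y \<in> R D" | "y \<notin> R C" "y \<in> R D" | "y \<notin> R C" "y \<notin> R D"
      by blast
    then show ?case
    proof cases
      case 1
      have "epowr (ennreal a + ennreal d) p = ennreal (a powr p) + ennreal ((a + d) powr p - a powr p)"
        using ad le by (simp add: epowr_ennreal flip: ennreal_plus)
      with 1 elim ad CD D show ?thesis
        by (simp add: rearr_nested_step distrib_right)
    next
      case 2
      with elim ad CD D show ?thesis
        by (simp add: rearr_nested_step epowr_ennreal)
    next
      case 3
      with elim ad CD D \<open>0 < p\<close> show ?thesis
        by (simp add: rearr_nested_step epowr_def)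
    qed
  qed
  then have "(\<integral>\<^sup>+y. epowr (rearr M R (nested_step a d D C) y) p * ennreal (v y) \<partial>N) =
      (\<integral>\<^sup>+y. ennreal (a powr p) * (ennreal (v y) * indicator (R D) y) +
      ennreal ((a + d) powr p - a powr p) * (ennreal (v y) * indicator (R C) y) \<partial>N)"
    by (rule nn_integral_cong_AE)
  also have "\<dots> = ennreal (a powr p) * Vmeas N v (R D) + ennreal ((a + d) powr p - a powr p) * Vmeas N v (R C)"
    by (simp add: nn_integral_add nn_integral_cmult Vmeas_def)
  finally show ?thesis .
qed

lemma nested_step_in_lorentz_space_iff:
  assumes F: "fatou_property M N R" and v: "v \<in> borel_measurable N" and "0 < p"
    and ad: "0 < a" "0 \<le> d" and CD: "C \<subseteq> D" "C \<in> sets M" "D \<in> sets M"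
  shows "nested_step a d D C \<in> lorentz_space M N R p v \<longleftrightarrow> Vmeas N v (R D) < \<infinity>"
proof -
  have "Vmeas N v (R C) \<le> Vmeas N v (R D)"
    by (intro Vmeas_mono_AE fatou_imp_mono_AE[OF F CD])
  then have "Vmeas N v (R C) < \<infinity>" if "Vmeas N v (R D) < \<infinity>"
    using that by (rule le_less_trans)
  then have "lorentz_norm M N R p v (nested_step a d D C) < \<infinity> \<longleftrightarrow> Vmeas N v (R D) < \<infinity>"
    using ad unfolding lorentz_norm_def epowr_less_top_iff nn_integral_rearr_nested_step[OF assms]
    by (auto simp: ennreal_mult_less_top)
  then show ?thesis
    using assms by (simp add: lorentz_space_def rearrangeable_nested_step)
qed

lemma lorentz_norm_nested_step:
  assumes F: "fatou_property M N R" and v: "v \<in> borel_measurable N" and "0 < p"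
    and ad: "0 < a" "0 \<le> d" and CD: "C \<subseteq> D" "C \<in> sets M" "D \<in> sets M"
    and V: "Vmeas N v (R D) = ennreal x" "Vmeas N v (R C) = ennreal y" "0 \<le> x" "0 \<le> y"
  shows "lorentz_norm M N R p v (nested_step a d D C) =
    ennreal ((a powr p * x + ((a + d) powr p - a powr p) * y) powr (1 / p))"
proof -
  have "a powr p \<le> (a + d) powr p"
    using ad \<open>0 < p\<close> by (intro powr_mono2) auto
  then show ?thesis
    using V by (simp add: lorentz_norm_def nn_integral_rearr_nested_step[OF assms(1-8)]
        epowr_ennreal flip: ennreal_mult ennreal_plus)
qed

end

section \<open>The first-order term of the triangle inequality\<close>

text \<open>Both sides of the hypothesis equal \<open>2 * W powr (1/p)\<close> at \<open>\<delta> = 0\<close>. Their derivatives at that point are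
  \<open>W powr (1/p - 1) * (W + x)\<close> and \<open>W powr (1/p - 1) * (\<alpha> + \<beta>)\<close>; a strict inequality in the wrong
  direction would violate the hypothesis for small \<open>\<delta>\<close>.\<close>

lemma submodular_from_minkowski:
  fixes W x \<alpha> \<beta> p :: real
  assumes W: "0 < W" and p: "0 < p"
    and ineq: "\<And>\<delta>. 0 < \<delta> \<Longrightarrow>
      ((2 + \<delta>) powr p * W + ((2 + \<delta> + \<delta>) powr p - (2 + \<delta>) powr p) * x) powr (1 / p) \<le>
      (1 powr p * W + ((1 + \<delta>) powr p - 1 powr p) * \<alpha>) powr (1 / p) +
      (1 powr p * W + ((1 + \<delta>) powr p - 1 powr p) * \<beta>) powr (1 / p)"
  shows "W + x \<le> \<alpha> + \<beta>"
proof -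
  define H where "H \<delta> =
      (W + ((1 + \<delta>) powr p - 1) * \<alpha>) powr (1 / p) + (W + ((1 + \<delta>) powr p - 1) * \<beta>) powr (1 / p)
      - ((2 + \<delta>) powr p * W + ((2 + \<delta> + \<delta>) powr p - (2 + \<delta>) powr p) * x) powr (1 / p)" for \<delta> :: real
  define c where "c = W powr (1 / p - 1)"
  have pos: "0 < W + ((1 + 0) powr p - 1) * \<alpha>" "0 < W + ((1 + 0) powr p - 1) * \<beta>"
    "0 < (2 + 0) powr p * W + ((2 + 0 + 0) powr p - (2 + 0) powr p) * x"
    using W by auto
  \<comment> \<open>The base point of the left-hand side carries a factor \<open>2 powr p\<close>; this cancels against the
      \<open>2 powr (p - 1)\<close> from its inner derivative, so that \<open>c\<close> is a common factor of all terms.\<close>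
  have "((2::real) powr p) powr (1 / p - 1) * 2 powr (p - 1) = 1"
  proof -
    have "p * (1 / p - 1) + (p - 1) = 0"
      using p by (simp add: field_simps)
    then show ?thesis
      by (simp add: powr_powr flip: powr_add)
  qed
  then have c2: "(2 powr p * W) powr (1 / p - 1) * 2 powr (p - 1) = c"
    using W by (simp add: powr_mult c_def)
  have "(H has_real_derivative
      (1 / p) * W powr (1 / p - 1) * (p * \<alpha>) + (1 / p) * W powr (1 / p - 1) * (p * \<beta>)
      - (1 / p) * (2 powr p * W) powr (1 / p - 1) * (p * 2 powr (p - 1) * (W + x))) (at 0)"
    unfolding H_def[abs_def] using pos p
    by (auto intro!: derivative_eq_intros simp: algebra_simps)
  also have "(1 / p) * W powr (1 / p - 1) * (p * \<alpha>) + (1 / p) * W powr (1 / p - 1) * (p * \<beta>)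
      - (1 / p) * (2 powr p * W) powr (1 / p - 1) * (p * 2 powr (p - 1) * (W + x))
      = c * \<alpha> + c * \<beta> - ((2 powr p * W) powr (1 / p - 1) * 2 powr (p - 1)) * (W + x)"
    using p by (simp add: c_def)
  also have "\<dots> = c * (\<alpha> + \<beta> - (W + x))"
    unfolding c2 by (simp add: algebra_simps)
  finally have deriv: "(H has_real_derivative c * (\<alpha> + \<beta> - (W + x))) (at 0)" .
  have H0: "H 0 = 0"
    using W p by (simp add: H_def powr_mult powr_powr)
  show ?thesis
  proof (rule ccontr)
    assume "\<not> ?thesis"
    then have "c * (\<alpha> + \<beta> - (W + x)) < 0"
      using W by (intro mult_pos_neg) (auto simp: c_def)
    from DERIV_neg_dec_right[OF deriv this] obtain e where
      e: "0 < e" "\<And>h. 0 < h \<Longrightarrow> h < e \<Longrightarrow> H (0 + h) < H 0"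
      by blast
    from e(2)[of "e / 2"] e(1) ineq[of "e / 2"] H0 show False
      by (simp add: H_def)
  qed
qed

section \<open>Submodularity\<close>

theorem theorem3p3:
  fixes M :: "'a measure" and N :: "'b measure"
    and R :: "'a set \<Rightarrow> 'b set" and v :: "'b \<Rightarrow> real" and p :: real
  assumes "set_transformation M N R"
    and "fatou_property M N R"
    and "1 \<le> p"
    and "weight M N R v"
    and "is_norm_mod_AE M (lorentz_space M N R p v) (lorentz_norm M N R p v)"
  shows "\<forall>A\<in>sets M. \<forall>B\<in>sets M.
    Vmeas N v (R (A \<union> B)) + Vmeas N v (R (A \<inter> B)) \<le> Vmeas N v (R A) + Vmeas N v (R B)"
proof (intro ballI)
  fix A B assume A: "A \<in> sets M" and B: "B \<in> sets M"
  interpret set_transformation M N R by fact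
  let ?W = "\<lambda>E. Vmeas N v (R E)" and ?S = "lorentz_space M N R p v"
    and ?\<rho> = "lorentz_norm M N R p v"
  note F = \<open>fatou_property M N R\<close>
  have v: "v \<in> borel_measurable N"
    using assms(4) by (simp add: weight_def)
  have p: "0 < p"
    using assms(3) by simp
  note norm = assms(5)[unfolded is_norm_mod_AE_def]
  note in_S = nested_step_in_lorentz_space_iff[OF F v p]
  note rho = lorentz_norm_nested_step[OF F v p]
  have sets [simp]: "A \<union> B \<in> sets M" "A \<inter> B \<in> sets M" "A \<in> sets M" "B \<in> sets M"
    using A B by auto
  have mono: "?W C \<le> ?W D" if "C \<subseteq> D" "C \<in> sets M" "D \<in> sets M" for C D
    by (intro Vmeas_mono_AE fatou_imp_mono_AE[OF F that])
  show "?W (A \<union> B) + ?W (A \<inter> B) \<le> ?W A + ?W B"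
  proof (cases "?W A < \<infinity> \<and> ?W B < \<infinity>")
    case False
    then have "?W A = \<infinity> \<or> ?W B = \<infinity>"
      by (auto simp flip: less_top)
    then have "?W A + ?W B = \<infinity>"
      by auto
    then show ?thesis
      by (metis infinity_ennreal_def top_greatest)
  next
    case fin: True
    \<comment> \<open>Closure of the space under \<open>\<chi>\<^sub>A + \<chi>\<^sub>B\<close> is what makes \<open>V(R (A \<union> B))\<close> finite.\<close>
    have "nested_step 1 0 A A \<in> ?S" "nested_step 1 0 B B \<in> ?S"
      using fin by (simp_all add: in_S)
    then have "(\<lambda>x. nested_step 1 0 A A x + nested_step 1 0 B B x) \<in> ?S"
      using norm by blast
    also have "(\<lambda>x. nested_step 1 0 A A x + nested_step 1 0 B B x) = nested_step 1 1 (A \<union> B) (A \<inter> B)"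
      by (auto simp: nested_step_def fun_eq_iff indicator_def)
    finally have "?W (A \<union> B) < \<infinity>"
      by (subst (asm) in_S) auto
    moreover have le: "?W (A \<inter> B) \<le> ?W (A \<union> B)"
      by (intro mono) auto
    ultimately have "?W (A \<inter> B) < \<infinity>"
      by (rule le_less_trans[rotated])
    have real: "\<exists>r\<ge>0. z = ennreal r" if "z < \<infinity>" for z
      using that by (cases z) auto
    obtain w where w: "?W (A \<union> B) = ennreal w" "0 \<le> w"
      using real[OF \<open>?W (A \<union> B) < \<infinity>\<close>] by blast
    obtain x where x: "?W (A \<inter> B) = ennreal x" "0 \<le> x"
      using real[OF \<open>?W (A \<inter> B) < \<infinity>\<close>] by blast
    obtain a where a: "?W A = ennreal a" "0 \<le> a"
      using real[of "?W A"] fin by blast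
    obtain b where b: "?W B = ennreal b" "0 \<le> b"
      using real[of "?W B"] fin by blast
    show ?thesis
    proof (cases "w = 0")
      case True
      with le w x show ?thesis
        by simp
    next
      case False
      then have "0 < w"
        using w by simp
      then have "w + x \<le> a + b"
        using p
      proof (rule submodular_from_minkowski)
        fix \<delta> :: real assume \<delta>: "0 < \<delta>"
        let ?f = "nested_step 1 \<delta> (A \<union> B) A" and ?g = "nested_step 1 \<delta> (A \<union> B) B"
        have "?f \<in> ?S" "?g \<in> ?S"
          using \<delta> w by (simp_all add: in_S)
        then have "?\<rho> (\<lambda>x. ?f x + ?g x) \<le> ?\<rho> ?f + ?\<rho> ?g"
          using norm by blast
        also have "(\<lambda>x. ?f x + ?g x) = nested_step (2 + \<delta>) \<delta> (A \<union> B) (A \<inter> B)"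
          by (auto simp: nested_step_def fun_eq_iff indicator_def)
        finally have "?\<rho> (nested_step (2 + \<delta>) \<delta> (A \<union> B) (A \<inter> B)) \<le> ?\<rho> ?f + ?\<rho> ?g" .
        moreover have "?\<rho> ?f = ennreal ((1 powr p * w + ((1 + \<delta>) powr p - 1 powr p) * a) powr (1 / p))"
          using \<delta> by (intro rho w a) auto
        moreover have "?\<rho> ?g = ennreal ((1 powr p * w + ((1 + \<delta>) powr p - 1 powr p) * b) powr (1 / p))"
          using \<delta> by (intro rho w b) auto
        moreover have "?\<rho> (nested_step (2 + \<delta>) \<delta> (A \<union> B) (A \<inter> B)) = ennreal (
            ((2 + \<delta>) powr p * w + ((2 + \<delta> + \<delta>) powr p - (2 + \<delta>) powr p) * x) powr (1 / p))"
          using \<delta> by (intro rho w x) auto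
        ultimately show "((2 + \<delta>) powr p * w + ((2 + \<delta> + \<delta>) powr p - (2 + \<delta>) powr p) * x) powr (1 / p) \<le>
            (1 powr p * w + ((1 + \<delta>) powr p - 1 powr p) * a) powr (1 / p) +
            (1 powr p * w + ((1 + \<delta>) powr p - 1 powr p) * b) powr (1 / p)"
          by (simp flip: ennreal_plus)
      qed
      then show ?thesis
        using w x a b by (simp flip: ennreal_plus)
    qed
  qed
qed

end
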